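(* Let $\Gamma:\ell_\infty^+\to\ell_\infty^+$ be a subadditive and homogeneous gain operator which is well-defined and continuous and satisfies the following assumptions: (i) $\inf_{n\in\mathbb{N}}\|\Gamma^n(\mathbb{1})\|_\infty<1$. (ii) There exists $c>1$ with $c^{-1}\le\gamma_{ij}\le c$ for all $i\in\mathbb{N}$ and $j\in I_i$ (where $\gamma_{ij}$ denotes the slope of the linear gain). (iii) For all $0<R_1<R_2$ there exists $l>0$ such that the MAFs $\mu_i$, $i\in\mathbb{N}$, satisfy $$\mu_i(s^2)-\mu_i(s^1)\ \ge\ l\,(s^2_j-s^1_j)$$ whenever $j\in I_i$ and $R_1\mathbb{1}\le s^1\le s^2\le R_2\mathbb{1}$. Then $\sigma:=\sigma_*=\sigma^*$ is a globally Lipschitz continuous path of decay for $\Gamma$ (in particular, $\sigma_*$ and $\sigma^*$ coincide).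
   Context: $\mathbb{N}=\{1,2,\dots\}$, $\mathbb{Z}_+=\{0,1,\dots\}$, $\mathbb{R}_+=[0,\infty)$. $\ell_\infty$ is the Banach space of bounded real sequences with sup norm $\|\cdot\|_\infty$; $\ell_\infty^+$ is the cone of nonnegative sequences; $\le$ is the componentwise order; $\oplus$, $\bigoplus$ denote componentwise max/supremum; $\mathbb{1}$ is the sequence with all components $1$. For $I\subseteq\mathbb{N}$, $\ell_\infty^+(I)=\{s\in\ell_\infty^+: s_i=0\ \forall i\notin I\}$. $\mathcal{K}$: continuous strictly increasing $\gamma:\mathbb{R}_+\to\mathbb{R}_+$ with $\gamma(0)=0$; $\mathcal{K}_\infty$: unbounded elements of $\mathcal{K}$. A monotone aggregation function (MAF) is $\mu:\ell_\infty^+\to[0,\infty]$ with $\mu(0)=0$; $s^1\le s^2\Rightarrow\mu(s^1)\le\mu(s^2)$; and $\mu$ finite-valued and continuous on $\ell_\infty^+(I)$ for every finite $I\subset\mathbb{N}$. Gain operator: for each $i\in\mathbb{N}$ one is given a finite set $I_i\subset\mathbb{N}\setminus\{i\}$, functions $\gamma_{ij}\in\mathcal{K}\cup\{0\}$ with $\gamma_{ij}=0$ for $j\notin I_i$, and a MAF $\mu_i$; $\Gamma(s)=(\mu_i([\gamma_{ij}(s_j)]_{j\in\mathbb{N}}))_{i\in\mathbb{N}}$. "Well-defined and continuous": $\Gamma$ maps $\ell_\infty^+$ into itself and is norm-continuous. $\Gamma$ is called subadditive and homogeneous if all $\gamma_{ij}$ are linear functions (identified with their slopes, $\gamma_{ij}(r)=\gamma_{ij}r$)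 and each $\mu_i$ satisfies $\mu_i(rs)=r\mu_i(s)$ for $r\ge0$, $s\in\ell_\infty^+$, and $\mu_i(s^1+s^2)\le\mu_i(s^1)+\mu_i(s^2)$ for $s^1,s^2\in\ell_\infty^+$. Augmented gain operator: $\hat\Gamma(s)=s\oplus\Gamma(s)$. $\sigma_*(r):=\bigoplus_{k=0}^\infty\hat\Gamma^k(r\mathbb{1})$ for $r\ge0$. For $r\ge0$, $\Gamma_r(s):=r\mathbb{1}\oplus\Gamma(s)$. $\sigma^*$ is defined by $\sigma^*_i(r):=\inf_{n\in\mathbb{Z}_+}\pi_i(\Gamma_r^n(\varphi(r)\mathbb{1}))$, $\pi_i$ being the $i$th coordinate, where $\varphi\in\mathcal{K}_\infty$ is a function witnessing the $\oplus$-MBI property of $\Gamma$, i.e. for all $s,b\in\ell_\infty^+$: $s\le\Gamma(s)\oplus b\Rightarrow\|s\|_\infty\le\varphi(\|b\|_\infty)$. (Under assumption (i), $\Gamma$ has the $\oplus$-MBI property, so such a $\varphi$ exists.) A path of decay for $\Gamma$ is a mapping $\sigma:\mathbb{R}_+\to\ell_\infty^+$, with components $\sigma_i$, such that: (P1) $\Gamma(\sigma(r))\le\sigma(r)$ for all $r\ge0$; (P2) there are $\sigma_{\min},\sigma_{\max}\in\mathcal{K}_\infty$ with $\sigma_{\min}\le\sigma_i\le\sigma_{\max}$ for all $i$; (P3) each $\sigma_i\in\mathcal{K}_\infty$; (P4) for every compact interval $J\subset(0,\infty)$ there are $0<c\le C<\infty$ with $c|r_1-r_2|\le|\sigma_i^{-1}(r_1)-\sigma_i^{-1}(r_2)|\le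 C|r_1-r_2|$ for all $r_1,r_2\in J$, $i\in\mathbb{N}$. *)

theory Defs
  imports "HOL-Analysis.Analysis"
begin

section \<open>The space of bounded sequences\<close>

text \<open>
  Bounded real sequences with the supremum norm are the bounded continuous functions on the
  discrete space \<^typ>\<open>nat\<close>. The index set \<open>{1, 2, \<dots>}\<close> is relabelled as \<open>{0, 1, \<dots>}\<close>.
\<close>

type_synonym linf = "nat \<Rightarrow>\<^sub>C real"

definition linf_le :: "linf \<Rightarrow> linf \<Rightarrow> bool" (infix \<open>\<sqsubseteq>\<close> 50) where
  "s \<sqsubseteq> t \<longleftrightarrow> (\<forall>i. s i \<le> t i)"

definition linf_max :: "linf \<Rightarrow> linf \<Rightarrow> linf" (infixl \<open>\<squnion>\<close> 65) where
  "s \<squnion> t = Bcontfun (\<lambda>i. max (s i) (t i))"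

definition linf_pos :: "linf set" where
  "linf_pos = {s :: linf. \<forall>i. 0 \<le> s i}"

definition linf_pos_on :: "nat set \<Rightarrow> linf set" where
  "linf_pos_on I = {s \<in> linf_pos. \<forall>i. i \<notin> I \<longrightarrow> s i = 0}"

section \<open>Comparison functions\<close>

text \<open>
  Functions on \<open>[0, \<infinity>)\<close> are functions on the reals of which only the restriction to \<open>{0..}\<close>
  matters; in the two classes below, nonnegativity follows from monotonicity and \<open>\<gamma> 0 = 0\<close>.
\<close>

definition class_K :: "(real \<Rightarrow> real) set" where
  "class_K = {\<gamma>. continuous_on {0..} \<gamma> \<and> strict_mono_on {0..} \<gamma> \<and> \<gamma> 0 = 0}"

definition class_K_inf :: "(real \<Rightarrow> real) set" where
  "class_K_inf = {\<gamma> \<in> class_K. \<not> bdd_above (\<gamma> ` {0..})}"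

section \<open>Monotone aggregation functions and gain operators\<close>

text \<open>
  An aggregation function may be infinite at points without finite support. In \<^typ>\<open>ennreal\<close> one has
  \<open>\<infinity> - x = \<infinity>\<close> for all \<open>x\<close>, so a lower bound on a difference \<open>\<mu> t - \<mu> s\<close> with \<open>s \<sqsubseteq> t\<close>
  imposes nothing if \<open>\<mu> s = \<infinity>\<close>; truncation at \<open>0\<close> does not occur because of monotonicity.
\<close>

definition MAF :: "(linf \<Rightarrow> ennreal) \<Rightarrow> bool" where
  "MAF \<mu> \<longleftrightarrow>
     \<mu> 0 = 0 \<and>
     (\<forall>s\<in>linf_pos. \<forall>t\<in>linf_pos. s \<sqsubseteq> t \<longrightarrow> \<mu> s \<le> \<mu> t) \<and>
     (\<forall>I. finite I \<longrightarrow>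
        (\<forall>s\<in>linf_pos_on I. \<mu> s < \<infinity>) \<and> continuous_on (linf_pos_on I) \<mu>)"

definition gain_data ::
  "(nat \<Rightarrow> nat set) \<Rightarrow> (nat \<Rightarrow> nat \<Rightarrow> real \<Rightarrow> real) \<Rightarrow> (nat \<Rightarrow> linf \<Rightarrow> ennreal) \<Rightarrow> bool" where
  "gain_data I \<gamma> \<mu> \<longleftrightarrow>
     (\<forall>i. finite (I i) \<and> i \<notin> I i) \<and>
     (\<forall>i j. \<gamma> i j \<in> class_K \<or> (\<forall>r\<ge>0. \<gamma> i j r = 0)) \<and>
     (\<forall>i j. j \<notin> I i \<longrightarrow> (\<forall>r\<ge>0. \<gamma> i j r = 0)) \<and>
     (\<forall>i. MAF (\<mu> i))"

definition gain_seq :: "(nat \<Rightarrow> nat \<Rightarrow> real \<Rightarrow> real) \<Rightarrow> nat \<Rightarrow> linf \<Rightarrow> linf" where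
  "gain_seq \<gamma> i s = Bcontfun (\<lambda>j. \<gamma> i j (s j))"

definition gain_comp ::
  "(nat \<Rightarrow> nat \<Rightarrow> real \<Rightarrow> real) \<Rightarrow> (nat \<Rightarrow> linf \<Rightarrow> ennreal) \<Rightarrow> linf \<Rightarrow> nat \<Rightarrow> ennreal" where
  "gain_comp \<gamma> \<mu> s i = \<mu> i (gain_seq \<gamma> i s)"

definition gain_well_defined ::
  "(nat \<Rightarrow> nat \<Rightarrow> real \<Rightarrow> real) \<Rightarrow> (nat \<Rightarrow> linf \<Rightarrow> ennreal) \<Rightarrow> bool" where
  "gain_well_defined \<gamma> \<mu> \<longleftrightarrow>
     (\<forall>s\<in>linf_pos. \<exists>t\<in>linf_pos. \<forall>i. gain_comp \<gamma> \<mu> s i = ennreal (t i))"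

text \<open>
  The operator as a self-map of \<^typ>\<open>linf\<close>; meaningful on \<open>linf_pos\<close> when
  \<open>gain_well_defined\<close> holds, see \<open>gain_op_apply\<close> below.
\<close>

definition gain_op ::
  "(nat \<Rightarrow> nat \<Rightarrow> real \<Rightarrow> real) \<Rightarrow> (nat \<Rightarrow> linf \<Rightarrow> ennreal) \<Rightarrow> linf \<Rightarrow> linf" where
  "gain_op \<gamma> \<mu> s = Bcontfun (\<lambda>i. enn2real (gain_comp \<gamma> \<mu> s i))"

definition slope :: "(real \<Rightarrow> real) \<Rightarrow> real" where
  "slope g = g 1"

definition subadditive_homogeneous ::
  "(nat \<Rightarrow> nat \<Rightarrow> real \<Rightarrow> real) \<Rightarrow> (nat \<Rightarrow> linf \<Rightarrow> ennreal) \<Rightarrow> bool" where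
  "subadditive_homogeneous \<gamma> \<mu> \<longleftrightarrow>
     (\<forall>i j. \<forall>r\<ge>0. \<gamma> i j r = slope (\<gamma> i j) * r) \<and>
     (\<forall>i. \<forall>r\<ge>0. \<forall>s\<in>linf_pos. \<mu> i (r *\<^sub>R s) = ennreal r * \<mu> i s) \<and>
     (\<forall>i. \<forall>s\<in>linf_pos. \<forall>t\<in>linf_pos. \<mu> i (s + t) \<le> \<mu> i s + \<mu> i t)"

section \<open>Extremal paths and paths of decay\<close>

text \<open>
  In this section \<open>G\<close> is a self-map of \<open>linf_pos\<close>, and \<open>const_bcontfun r\<close> is the sequence with
  all components equal to \<open>r\<close>. The supremum and infimum defining the two extremal paths are taken
  in the extended reals, so that finiteness is not presupposed.
\<close>

definition augmented :: "(linf \<Rightarrow> linf) \<Rightarrow> linf \<Rightarrow> linf" where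
  "augmented G s = s \<squnion> G s"

definition augmented_by :: "(linf \<Rightarrow> linf) \<Rightarrow> real \<Rightarrow> linf \<Rightarrow> linf" where
  "augmented_by G r s = const_bcontfun r \<squnion> G s"

definition lower_path :: "(linf \<Rightarrow> linf) \<Rightarrow> real \<Rightarrow> nat \<Rightarrow> ereal" where
  "lower_path G r i = (SUP k. ereal ((augmented G ^^ k) (const_bcontfun r) i))"

definition upper_path :: "(linf \<Rightarrow> linf) \<Rightarrow> (real \<Rightarrow> real) \<Rightarrow> real \<Rightarrow> nat \<Rightarrow> ereal" where
  "upper_path G \<phi> r i = (INF n. ereal ((augmented_by G r ^^ n) (const_bcontfun (\<phi> r)) i))"

definition MBI_witness :: "(linf \<Rightarrow> linf) \<Rightarrow> (real \<Rightarrow> real) \<Rightarrow> bool" where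
  "MBI_witness G \<phi> \<longleftrightarrow> \<phi> \<in> class_K_inf \<and>
     (\<forall>s\<in>linf_pos. \<forall>b\<in>linf_pos. s \<sqsubseteq> G s \<squnion> b \<longrightarrow> norm s \<le> \<phi> (norm b))"

definition inverse_component :: "(real \<Rightarrow> linf) \<Rightarrow> nat \<Rightarrow> real \<Rightarrow> real" where
  "inverse_component \<sigma> i = inv_into {0..} (\<lambda>r. \<sigma> r i)"

definition path_of_decay :: "(linf \<Rightarrow> linf) \<Rightarrow> (real \<Rightarrow> linf) \<Rightarrow> bool" where
  "path_of_decay G \<sigma> \<longleftrightarrow>
     (\<forall>r\<ge>0. \<sigma> r \<in> linf_pos) \<and>
     (\<forall>r\<ge>0. G (\<sigma> r) \<sqsubseteq> \<sigma> r) \<and>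
     (\<exists>\<sigma>min\<in>class_K_inf. \<exists>\<sigma>max\<in>class_K_inf.
        \<forall>i. \<forall>r\<ge>0. \<sigma>min r \<le> \<sigma> r i \<and> \<sigma> r i \<le> \<sigma>max r) \<and>
     (\<forall>i. (\<lambda>r. \<sigma> r i) \<in> class_K_inf) \<and>
     (\<forall>a b. 0 < a \<and> a \<le> b \<longrightarrow>
        (\<exists>c C. 0 < c \<and> c \<le> C \<and>
          (\<forall>r1\<in>{a..b}. \<forall>r2\<in>{a..b}. \<forall>i.
             c * \<bar>r1 - r2\<bar> \<le> \<bar>inverse_component \<sigma> i r1 - inverse_component \<sigma> i r2\<bar> \<and>
             \<bar>inverse_component \<sigma> i r1 - inverse_component \<sigma> i r2\<bar> \<le> C * \<bar>r1 - r2\<bar>)))"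

section \<open>The coercions into the sequence space are proper\<close>

lemma linf_max_apply: "(s \<squnion> t) i = max (s i) (t i)"
proof -
  obtain A B where "\<And>i. \<bar>s i\<bar> \<le> A" "\<And>i. \<bar>t i\<bar> \<le> B"
    using bounded_apply_bcontfun[of s] bounded_apply_bcontfun[of t]
    by (auto simp: bounded_iff)
  then have "\<bar>max (s i) (t i)\<bar> \<le> max A B" for i
    by (smt (verit, best))
  then have "(\<lambda>i. max (s i) (t i)) \<in> bcontfun"
    by (auto simp: bcontfun_def bounded_iff)
  then show ?thesis
    by (simp add: linf_max_def Bcontfun_inverse)
qed

lemma gain_seq_apply:
  assumes "gain_data I \<gamma> \<mu>" "s \<in> linf_pos"
  shows "gain_seq \<gamma> i s j = \<gamma> i j (s j)"
proof -
  have "range (\<lambda>j. \<gamma> i j (s j)) \<subseteq> insert 0 ((\<lambda>j. \<gamma> i j (s j)) ` I i)"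
  proof (rule image_subsetI)
    fix j
    show "\<gamma> i j (s j) \<in> insert 0 ((\<lambda>j. \<gamma> i j (s j)) ` I i)"
      using assms by (cases "j \<in> I i") (auto simp: gain_data_def linf_pos_def)
  qed
  moreover have "finite (I i)"
    using assms by (auto simp: gain_data_def)
  ultimately have "bounded (range (\<lambda>j. \<gamma> i j (s j)))"
    by (meson finite_imageI finite_imp_bounded finite_insert bounded_subset)
  then show ?thesis
    by (simp add: gain_seq_def Bcontfun_inverse bcontfun_def)
qed

lemma gain_op_apply:
  assumes "gain_well_defined \<gamma> \<mu>" "s \<in> linf_pos"
  shows "gain_op \<gamma> \<mu> s \<in> linf_pos" "ennreal (gain_op \<gamma> \<mu> s i) = gain_comp \<gamma> \<mu> s i"
proof -
  obtain t where t: "t \<in> linf_pos" "\<And>i. gain_comp \<gamma> \<mu> s i = ennreal (t i)"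
    using assms unfolding gain_well_defined_def by blast
  then have "(\<lambda>i. enn2real (gain_comp \<gamma> \<mu> s i)) = apply_bcontfun t"
    by (auto simp: linf_pos_def)
  then have "gain_op \<gamma> \<mu> s = t"
    by (simp add: gain_op_def apply_bcontfun_inverse)
  with t show "gain_op \<gamma> \<mu> s \<in> linf_pos" "ennreal (gain_op \<gamma> \<mu> s i) = gain_comp \<gamma> \<mu> s i"
    by auto
qed

end

theory Submission
  imports Defs
begin

text \<open>
  By homogeneity \<open>\<sigma>\<^sub>*(r) = r e\<close> with \<open>e = \<sigma>\<^sub>*(1)\<close>, and \<open>\<one> \<le> e \<le> C \<one>\<close> by the
  \<open>\<oplus>\<close>-MBI property, so that a path of this form is a globally Lipschitz path of decay as soon as
  \<open>\<Gamma>(e) \<le> e\<close>. This inequality holds because each component of \<open>\<Gamma>\<close> depends continuously on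
  finitely many coordinates; in fact \<open>e\<close> is a fixed point of \<open>\<Gamma>\<^sub>1\<close>. By subadditivity,
  \<open>\<Gamma>\<^sub>r\<^sup>n(t) - \<Gamma>\<^sub>r\<^sup>n(s) \<le> \<Gamma>\<^sup>n(t - s)\<close> for \<open>s \<le> t\<close>, and the right-hand side gets arbitrarily
  small since \<open>\<parallel>\<Gamma>\<^sup>m(\<one>)\<parallel> < 1\<close> for some \<open>m\<close>. Applied to \<open>s = r e\<close> and \<open>t = \<phi>(r) \<one>\<close>, this
  yields \<open>\<sigma>\<^sup>*(r) = r e\<close>.
\<close>

section \<open>Bounded sequences and comparison functions\<close>

lemma linf_posI: "(\<And>i. 0 \<le> s i) \<Longrightarrow> s \<in> linf_pos"
  and linf_posD: "s \<in> linf_pos \<Longrightarrow> 0 \<le> s i"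
  for s :: linf
  by (auto simp: linf_pos_def)

lemma linf_le_norm: "(s :: linf) i \<le> norm s"
  using norm_bounded[of s i] by simp

lemma linf_norm_le:
  fixes s :: linf
  assumes "s \<in> linf_pos" "\<And>i. s i \<le> c"
  shows "norm s \<le> c"
  using assms by (intro norm_bound) (simp add: linf_posD)

lemma norm_const_linf: "0 \<le> r \<Longrightarrow> norm (const_bcontfun r :: linf) = r"
  using linf_le_norm[of "const_bcontfun r" 0]
  by (intro antisym linf_norm_le linf_posI) simp_all

lemma const_bcontfun_eq_scaleR: "const_bcontfun r = r *\<^sub>R (const_bcontfun 1 :: linf)"
  by (rule bcontfun_eqI) simp

lemma augmented_apply: "augmented G s i = max (s i) (G s i)"
  by (simp add: augmented_def linf_max_apply)

lemma augmented_by_apply: "augmented_by G r s i = max r (G s i)"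
  by (simp add: augmented_by_def linf_max_apply)

lemma linear_class_K_inf:
  assumes c: "0 < c"
  shows "(\<lambda>r. r * c) \<in> class_K_inf"
proof -
  have "\<not> bdd_above ((\<lambda>r. r * c) ` {0..})"
  proof
    assume "bdd_above ((\<lambda>r. r * c) ` {0..})"
    then obtain M where M: "\<And>r. 0 \<le> r \<Longrightarrow> r * c \<le> M"
      by (auto simp: bdd_above_def)
    have "0 \<le> (\<bar>M\<bar> + 1) / c"
      using c by simp
    from M[OF this] show False
      using c by simp
  qed
  with c show ?thesis
    by (auto simp: class_K_inf_def class_K_def strict_mono_on_def intro!: continuous_intros)
qed

text \<open>On sequences supported in a fixed finite set, the sup norm of a difference is at most
  the finite sum of its absolute coordinates, so coordinatewise convergence is norm convergence.
  This makes the continuity of an aggregation function on finite supports applicable.\<close>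

lemma tendsto_finite_support:
  fixes S :: "nat \<Rightarrow> linf"
  assumes "finite I"
    and "\<And>n. S n \<in> linf_pos_on I" "t \<in> linf_pos_on I"
    and "\<And>j. (\<lambda>n. S n j) \<longlonglongrightarrow> t j"
  shows "S \<longlonglongrightarrow> t"
proof -
  have bound: "norm (S n - t) \<le> (\<Sum>j\<in>I. \<bar>S n j - t j\<bar>)" for n
  proof (rule norm_bound)
    fix j
    show "norm ((S n - t) j) \<le> (\<Sum>j\<in>I. \<bar>S n j - t j\<bar>)"
    proof (cases "j \<in> I")
      case True
      then show ?thesis
        using member_le_sum[of j I "\<lambda>j. \<bar>S n j - t j\<bar>"] assms(1) by simp
    next
      case False
      then show ?thesis
        using assms(2)[of n] assms(3) by (simp add: linf_pos_on_def sum_nonneg)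
    qed
  qed
  have "(\<lambda>n. \<Sum>j\<in>I. \<bar>S n j - t j\<bar>) \<longlonglongrightarrow> (\<Sum>j\<in>I. 0)"
    using assms(4) by (intro tendsto_sum tendsto_rabs_zero) (simp add: LIM_zero)
  then have "(\<lambda>n. S n - t) \<longlonglongrightarrow> 0"
    using bound by (intro Lim_null_comparison[of "\<lambda>n. S n - t"]) auto
  then show ?thesis
    by (simp add: LIM_zero_iff)
qed

section \<open>Subadditive homogeneous operators\<close>

text \<open>All conditions are restricted to \<open>linf_pos\<close>, since \<open>gain_op\<close>
  is meaningful only on that cone.\<close>

locale subadditive_operator =
  fixes G :: "linf \<Rightarrow> linf"
  assumes pos: "s \<in> linf_pos \<Longrightarrow> G s \<in> linf_pos"
    and mono: "s \<in> linf_pos \<Longrightarrow> t \<in> linf_pos \<Longrightarrow> s \<sqsubseteq> t \<Longrightarrow> G s \<sqsubseteq> G t"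
    and homogeneous: "0 \<le> r \<Longrightarrow> s \<in> linf_pos \<Longrightarrow> G (r *\<^sub>R s) = r *\<^sub>R G s"
    and subadditive: "s \<in> linf_pos \<Longrightarrow> t \<in> linf_pos \<Longrightarrow> G (s + t) \<sqsubseteq> G s + G t"
begin

section \<open>Iterates of \<open>G\<close> on the cone\<close>

lemma funpow_pos: "s \<in> linf_pos \<Longrightarrow> (G ^^ n) s \<in> linf_pos"
  by (induction n) (auto intro: pos)

lemma funpow_le:
  "s \<in> linf_pos \<Longrightarrow> t \<in> linf_pos \<Longrightarrow> s \<sqsubseteq> t \<Longrightarrow> (G ^^ n) s \<sqsubseteq> (G ^^ n) t"
  by (induction n) (auto intro!: mono funpow_pos)

lemma funpow_homogeneous:
  "0 \<le> r \<Longrightarrow> s \<in> linf_pos \<Longrightarrow> (G ^^ n) (r *\<^sub>R s) = r *\<^sub>R (G ^^ n) s"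
  by (induction n) (auto simp: homogeneous funpow_pos)

lemma funpow_subadditive:
  assumes "s \<in> linf_pos" "t \<in> linf_pos"
  shows "(G ^^ n) (s + t) \<sqsubseteq> (G ^^ n) s + (G ^^ n) t"
proof (induction n)
  case 0
  show ?case by (simp add: linf_le_def)
next
  case (Suc n)
  have sum_pos: "u + v \<in> linf_pos" if "u \<in> linf_pos" "v \<in> linf_pos" for u v :: linf
    using that by (simp add: linf_pos_def)
  have "G ((G ^^ n) (s + t)) \<sqsubseteq> G ((G ^^ n) s + (G ^^ n) t)"
    by (intro mono funpow_pos sum_pos assms Suc)
  moreover have "G ((G ^^ n) s + (G ^^ n) t) \<sqsubseteq> G ((G ^^ n) s) + G ((G ^^ n) t)"
    by (intro subadditive funpow_pos assms)
  ultimately show ?case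
    by (auto simp: linf_le_def intro: order_trans)
qed

text \<open>Monotonicity and homogeneity applied to \<open>s\<close> \<le> \<open>norm s\<close>
  times the unit sequence. Thus the norm of the \<open>n\<close>-th iterate of the unit sequence
  plays the role of an operator norm on the cone.\<close>

lemma funpow_le_norm:
  assumes "s \<in> linf_pos"
  shows "(G ^^ n) s i \<le> norm s * norm ((G ^^ n) (const_bcontfun 1))"
proof -
  have one: "(const_bcontfun 1 :: linf) \<in> linf_pos"
    by (simp add: linf_pos_def)
  have "s \<sqsubseteq> norm s *\<^sub>R const_bcontfun 1"
    using linf_le_norm by (simp add: linf_le_def)
  then have "(G ^^ n) s \<sqsubseteq> (G ^^ n) (norm s *\<^sub>R const_bcontfun 1)"
    using assms by (intro funpow_le) (auto simp: linf_pos_def)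
  also have "(G ^^ n) (norm s *\<^sub>R const_bcontfun 1) = norm s *\<^sub>R (G ^^ n) (const_bcontfun 1)"
    by (intro funpow_homogeneous one) simp
  finally have "(G ^^ n) s i \<le> norm s * (G ^^ n) (const_bcontfun 1) i"
    by (simp add: linf_le_def)
  also have "\<dots> \<le> norm s * norm ((G ^^ n) (const_bcontfun 1))"
    by (intro mult_left_mono linf_le_norm) simp
  finally show ?thesis .
qed

text \<open>The maximum of nonnegative sequences is below their sum, so \<open>s\<close> \<le>
  \<open>G s + b\<close>. Inserting this inequality into itself \<open>n\<close> times and splitting
  by subadditivity leaves the partial sum of a Neumann series in \<open>b\<close>.\<close>

lemma MBI_unfold:
  assumes "s \<in> linf_pos" "b \<in> linf_pos" "s \<sqsubseteq> G s \<squnion> b"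
  shows "s i \<le> (G ^^ n) s i + (\<Sum>k<n. (G ^^ k) b i)"
proof (induction n)
  case 0
  show ?case by simp
next
  case (Suc n)
  have "s j \<le> G s j + b j" for j
    using assms pos[OF assms(1)]
    by (smt (verit) linf_le_def linf_max_apply linf_posD)
  then have "(G ^^ n) s \<sqsubseteq> (G ^^ n) (G s + b)"
    using assms pos[OF assms(1)] by (intro funpow_le) (auto simp: linf_pos_def linf_le_def)
  moreover have "(G ^^ n) (G s + b) \<sqsubseteq> (G ^^ n) (G s) + (G ^^ n) b"
    by (intro funpow_subadditive pos assms)
  ultimately have "(G ^^ n) s i \<le> (G ^^ Suc n) s i + (G ^^ n) b i"
    by (auto simp: linf_le_def funpow_swap1 intro: order_trans)
  with Suc show ?case
    by simp
qed

section \<open>Iterates of the augmented operators\<close>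

lemma augmented_funpow_pos: "s \<in> linf_pos \<Longrightarrow> (augmented G ^^ k) s \<in> linf_pos"
  by (induction k) (auto simp: linf_pos_def augmented_apply le_max_iff_disj)

lemma augmented_funpow_homogeneous:
  assumes "0 \<le> r" "s \<in> linf_pos"
  shows "(augmented G ^^ k) (r *\<^sub>R s) = r *\<^sub>R (augmented G ^^ k) s"
proof (induction k)
  case (Suc k)
  show ?case
  proof (rule bcontfun_eqI)
    fix i
    show "(augmented G ^^ Suc k) (r *\<^sub>R s) i = (r *\<^sub>R (augmented G ^^ Suc k) s) i"
      using assms by (simp add: Suc augmented_apply homogeneous augmented_funpow_pos
          max_mult_distrib_left)
  qed
qed simp

lemma augmented_funpow_incseq: "incseq (\<lambda>k. (augmented G ^^ k) s i)"
  by (rule incseq_SucI) (simp add: augmented_apply)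

text \<open>The iterates increase, so by monotonicity the older term \<open>G (?s k)\<close> hidden
  in \<open>?s (Suc k)\<close> is absorbed by \<open>G (?s (Suc k))\<close>, and only the constant
  \<open>r\<close> survives. This links the lower path to the operator that defines the upper
  path.\<close>

lemma augmented_funpow_Suc_eq:
  assumes "0 \<le> r"
  shows "(augmented G ^^ Suc k) (const_bcontfun r)
    = augmented_by G r ((augmented G ^^ k) (const_bcontfun r))"
proof (induction k)
  case 0
  show ?case
    by (rule bcontfun_eqI) (simp add: augmented_apply augmented_by_apply)
next
  case (Suc k)
  let ?s = "\<lambda>k. (augmented G ^^ k) (const_bcontfun r)"
  have p: "?s k \<in> linf_pos" for k
    using assms by (intro augmented_funpow_pos) (simp add: linf_pos_def)
  have "?s k \<sqsubseteq> ?s (Suc k)"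
    by (simp add: linf_le_def augmented_apply)
  then have "G (?s k) \<sqsubseteq> G (?s (Suc k))"
    by (intro mono p)
  then have le: "G (?s k) i \<le> G (?s (Suc k)) i" for i
    by (simp add: linf_le_def)
  show ?case
  proof (rule bcontfun_eqI)
    fix i
    have "?s (Suc (Suc k)) i = max (?s (Suc k) i) (G (?s (Suc k)) i)"
      by (simp add: augmented_apply)
    also have "?s (Suc k) i = max r (G (?s k) i)"
      by (simp only: Suc augmented_by_apply)
    finally show "?s (Suc (Suc k)) i = augmented_by G r (?s (Suc k)) i"
      unfolding augmented_by_apply using le[of i] by linarith
  qed
qed

lemma augmented_by_pos: "0 \<le> r \<Longrightarrow> augmented_by G r s \<in> linf_pos"
  by (rule linf_posI) (simp add: augmented_by_apply)

text \<open>Taking the maximum with \<open>r\<close> preserves order and does not increase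
  differences, and subadditivity bounds \<open>G y - G x\<close> by \<open>G (y - x)\<close>. Both
  claims go through one induction, because \<open>y - x\<close> has to lie in the cone before
  \<open>G\<close> can be applied to it.\<close>

lemma augmented_by_funpow_diff:
  assumes "0 \<le> r" "s \<in> linf_pos" "t \<in> linf_pos" "s \<sqsubseteq> t"
  shows "(augmented_by G r ^^ n) s \<sqsubseteq> (augmented_by G r ^^ n) t
    \<and> (augmented_by G r ^^ n) t - (augmented_by G r ^^ n) s \<sqsubseteq> (G ^^ n) (t - s)"
proof (induction n)
  case 0
  show ?case
    using assms by (simp add: linf_le_def)
next
  case (Suc n)
  define x where "x = (augmented_by G r ^^ n) s"
  define y where "y = (augmented_by G r ^^ n) t"
  \<comment> \<open>For \<open>n = 0\<close> membership comes from \<open>s\<close> and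
    \<open>t\<close>; every later iterate is at least \<open>r\<close> \<ge> 0.\<close>
  have p: "x \<in> linf_pos" "y \<in> linf_pos"
    using assms unfolding x_def y_def by (cases n; simp add: augmented_by_pos)+
  have xy: "x \<sqsubseteq> y" and d: "y - x \<sqsubseteq> (G ^^ n) (t - s)"
    using Suc by (auto simp: x_def y_def)
  have dp: "y - x \<in> linf_pos" "t - s \<in> linf_pos"
    using xy assms(4) by (auto simp: linf_pos_def linf_le_def)
  have le: "G x \<sqsubseteq> G y"
    by (intro mono p xy)
  have "G (x + (y - x)) \<sqsubseteq> G x + G (y - x)"
    by (intro subadditive p dp)
  moreover have "G (y - x) \<sqsubseteq> G ((G ^^ n) (t - s))"
    by (intro mono dp d funpow_pos)
  ultimately have "G y i - G x i \<le> G ((G ^^ n) (t - s)) i" for i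
    by (simp add: linf_le_def) (smt (verit))
  with le have "max r (G x i) \<le> max r (G y i)"
    and "max r (G y i) - max r (G x i) \<le> G ((G ^^ n) (t - s)) i" for i
    by (smt (verit) linf_le_def)+
  then show ?case
    by (simp add: linf_le_def augmented_by_apply x_def y_def)
qed

end

text \<open>\<open>finitary\<close> asks for continuity of each component under coordinatewise
  convergence, the only convergence that bounded increasing iterates supply. In
  \<open>contractive\<close> the index 0 is harmless, since the unit sequence has norm 1.\<close>

locale contractive_operator = subadditive_operator +
  assumes finitary: "(\<And>n :: nat. S n \<in> linf_pos) \<Longrightarrow> t \<in> linf_pos \<Longrightarrow>
      (\<And>j. (\<lambda>n. S n j) \<longlonglongrightarrow> t j) \<Longrightarrow> (\<lambda>n. G (S n) i) \<longlonglongrightarrow> G t i"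
    and contractive: "\<exists>n. norm ((G ^^ n) (const_bcontfun 1)) < 1"
begin

text \<open>By \<open>funpow_le_norm\<close> the norms are submultiplicative, so along the multiples
  of a contractive exponent \<open>m\<close> they are bounded by the powers of some
  \<open>q < 1\<close>.\<close>

lemma norm_funpow_small:
  assumes "0 < \<epsilon>"
  shows "\<exists>n. norm ((G ^^ n) (const_bcontfun 1)) < \<epsilon>"
proof -
  obtain m where m: "norm ((G ^^ m) (const_bcontfun 1)) < 1"
    using contractive by blast
  define q where "q = norm ((G ^^ m) (const_bcontfun 1))"
  have one: "(const_bcontfun 1 :: linf) \<in> linf_pos"
    by (simp add: linf_pos_def)
  have power: "norm ((G ^^ (k * m)) (const_bcontfun 1)) \<le> q ^ k" for k
  proof (induction k)
    case 0
    show ?case by (simp add: norm_const_linf)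
  next
    case (Suc k)
    have "(G ^^ (Suc k * m)) (const_bcontfun 1)
      = (G ^^ m) ((G ^^ (k * m)) (const_bcontfun 1))"
      by (simp add: funpow_add)
    moreover have "norm ((G ^^ m) ((G ^^ (k * m)) (const_bcontfun 1)))
      \<le> norm ((G ^^ (k * m)) (const_bcontfun 1)) * q"
      unfolding q_def by (intro linf_norm_le funpow_le_norm funpow_pos one)
    moreover have "norm ((G ^^ (k * m)) (const_bcontfun 1)) * q \<le> q ^ k * q"
      using Suc by (intro mult_right_mono) (simp_all add: q_def)
    ultimately show ?case
      by (simp add: mult.commute)
  qed
  obtain k where "q ^ k < \<epsilon>"
    using real_arch_pow_inv[OF assms, of q] m q_def by blast
  with power[of k] show ?thesis
    by (meson le_less_trans)
qed

text \<open>Unfolding \<open>m\<close> times, with \<open>m\<close> a contractive exponent, puts a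
  factor \<open>q < 1\<close> in front of \<open>norm s\<close> on the right, where it can be
  absorbed.\<close>

lemma MBI_linear:
  obtains C where "1 \<le> C"
    and "\<And>s b. s \<in> linf_pos \<Longrightarrow> b \<in> linf_pos \<Longrightarrow> s \<sqsubseteq> G s \<squnion> b \<Longrightarrow> norm s \<le> C * norm b"
proof -
  obtain m where m: "norm ((G ^^ m) (const_bcontfun 1)) < 1"
    using contractive by blast
  define q where "q = norm ((G ^^ m) (const_bcontfun 1))"
  define A where "A = (\<Sum>k<m. norm ((G ^^ k) (const_bcontfun 1)))"
  have q: "q < 1"
    using m by (simp add: q_def)
  show ?thesis
  proof
    \<comment> \<open>The quotient comes from solving \<open>norm s\<close> \<le>
      \<open>norm s * q + norm b * A\<close> for \<open>norm s\<close>. The maximum with 1 ensures a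
      positive slope, so that the bound is a function in \<open>class_K_inf\<close>.\<close>
    show "1 \<le> max 1 (A / (1 - q))"
      by simp
    fix s b :: linf
    assume s: "s \<in> linf_pos" and b: "b \<in> linf_pos" and sb: "s \<sqsubseteq> G s \<squnion> b"
    have "s i \<le> norm s * q + norm b * A" for i
    proof -
      have "s i \<le> (G ^^ m) s i + (\<Sum>k<m. (G ^^ k) b i)"
        by (rule MBI_unfold[OF s b sb])
      also have "\<dots> \<le> norm s * q + (\<Sum>k<m. norm b * norm ((G ^^ k) (const_bcontfun 1)))"
        unfolding q_def by (intro add_mono sum_mono funpow_le_norm s b)
      finally show ?thesis
        by (simp add: A_def sum_distrib_left)
    qed
    then have "norm s \<le> norm s * q + norm b * A"
      by (intro linf_norm_le s)
    then have "norm s \<le> A / (1 - q) * norm b"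
      using q by (simp add: field_simps)
    also have "\<dots> \<le> max 1 (A / (1 - q)) * norm b"
      by (intro mult_right_mono) simp_all
    finally show "norm s \<le> max 1 (A / (1 - q)) * norm b" .
  qed
qed

lemma MBI_witness_exists: "\<exists>\<phi>. MBI_witness G \<phi>"
proof -
  obtain C where "1 \<le> C"
    and "\<And>s b. s \<in> linf_pos \<Longrightarrow> b \<in> linf_pos \<Longrightarrow> s \<sqsubseteq> G s \<squnion> b \<Longrightarrow> norm s \<le> C * norm b"
    using MBI_linear by blast
  then have "MBI_witness G (\<lambda>r. r * C)"
    using linear_class_K_inf[of C] by (auto simp: MBI_witness_def mult.commute)
  then show ?thesis
    by blast
qed

text \<open>The augmented iterates of the unit sequence increase and are bounded by the MBI
  estimate, hence converge coordinatewise; \<open>e\<close> is the limit, and the recursion of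
  \<open>augmented_funpow_Suc_eq\<close> passes to it.\<close>

lemma extremal_fixed_point:
  obtains e :: linf and C where "\<And>i. 1 \<le> e i" "\<And>i. e i \<le> C"
    and "augmented_by G 1 e = e"
    and "\<And>i. (\<lambda>k. (augmented G ^^ k) (const_bcontfun 1) i) \<longlonglongrightarrow> e i"
proof -
  obtain C where C: "1 \<le> C"
    and mbi: "\<And>s b. s \<in> linf_pos \<Longrightarrow> b \<in> linf_pos \<Longrightarrow> s \<sqsubseteq> G s \<squnion> b \<Longrightarrow> norm s \<le> C * norm b"
    using MBI_linear by blast
  let ?s = "\<lambda>k. (augmented G ^^ k) (const_bcontfun 1)"
  have one: "(const_bcontfun 1 :: linf) \<in> linf_pos"
    by (simp add: linf_pos_def)
  have p: "?s k \<in> linf_pos" for k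
    by (intro augmented_funpow_pos one)
  have inc: "incseq (\<lambda>k. ?s k i)" for i
    by (rule augmented_funpow_incseq)
  have ge: "1 \<le> ?s k i" for k i
    using incseqD[OF inc[of i], of 0 k] by simp
  have step: "?s (Suc k) i = max 1 (G (?s k) i)" for k i
    by (simp only: augmented_funpow_Suc_eq[of 1] augmented_by_apply zero_le_one)
  \<comment> \<open>\<open>?s k\<close> \<le> \<open>?s (Suc k)\<close>, and the latter is the
    maximum of 1 and \<open>G (?s k)\<close>; this is the premise of the MBI estimate with the unit
    sequence as \<open>b\<close>.\<close>
  have "?s k \<sqsubseteq> G (?s k) \<squnion> const_bcontfun 1" for k
    unfolding linf_le_def linf_max_apply
    using step incseqD[OF inc, of k "Suc k"] by (simp add: max.commute)
  from mbi[OF p one this] have "norm (?s k) \<le> C" for k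
    by (simp add: norm_const_linf)
  then have le: "?s k i \<le> C" for k i
    using linf_le_norm order_trans by blast
  then have bdd: "bdd_above (range (\<lambda>k. ?s k i))" for i
    by (auto simp: bdd_above_def)
  have lim: "(\<lambda>k. ?s k i) \<longlonglongrightarrow> (SUP k. ?s k i)" for i
    by (rule LIMSEQ_incseq_SUP[OF bdd inc])
  have sup: "1 \<le> (SUP k. ?s k i)" "(SUP k. ?s k i) \<le> C" for i
    using LIMSEQ_le_const[OF lim] LIMSEQ_le_const2[OF lim] ge le by blast+
  define e where "e = Bcontfun (\<lambda>i. SUP k. ?s k i)"
  have "(\<lambda>i. SUP k. ?s k i) \<in> bcontfun"
    unfolding bcontfun_def using sup
    by (auto simp: bounded_iff intro!: exI[of _ C]) (smt (verit) sup)
  then have e: "e i = (SUP k. ?s k i)" for i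
    by (simp add: e_def Bcontfun_inverse)
  have ep: "e \<in> linf_pos"
    using sup(1) by (intro linf_posI) (smt (verit) e)
  have lim_e: "(\<lambda>k. ?s k i) \<longlonglongrightarrow> e i" for i
    using lim e by simp
  have "augmented_by G 1 e = e"
  proof (rule bcontfun_eqI)
    fix i
    have "(\<lambda>k. max 1 (G (?s k) i)) \<longlonglongrightarrow> max 1 (G e i)"
      by (intro tendsto_max tendsto_const finitary p ep lim_e)
    moreover have "(\<lambda>k. ?s (Suc k) i) \<longlonglongrightarrow> e i"
      by (rule LIMSEQ_Suc[OF lim_e])
    ultimately show "augmented_by G 1 e i = e i"
      unfolding augmented_by_apply step using LIMSEQ_unique by blast
  qed
  with that[of e C] sup e lim_e show ?thesis
    by simp
qed

section \<open>Identification of the two extremal paths\<close>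

lemma augmented_by_scaleR:
  assumes "0 \<le> r" "e \<in> linf_pos" "augmented_by G 1 e = e"
  shows "augmented_by G r (r *\<^sub>R e) = r *\<^sub>R e"
proof (rule bcontfun_eqI)
  fix i
  have "max 1 (G e i) = e i"
    using assms(3) augmented_by_apply by metis
  then have "r * e i = max r (r * G e i)"
    using max_mult_distrib_left[of r 1 "G e i"] assms(1) by simp
  then show "augmented_by G r (r *\<^sub>R e) i = (r *\<^sub>R e) i"
    using assms by (simp add: augmented_by_apply homogeneous)
qed

text \<open>Homogeneity reduces every \<open>r\<close> \<ge> 0 to the case 1, and the supremum of an
  increasing sequence is its limit.\<close>

lemma lower_path_eq:
  fixes e :: linf
  assumes "0 \<le> r" "(\<lambda>k. (augmented G ^^ k) (const_bcontfun 1) i) \<longlonglongrightarrow> e i"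
  shows "lower_path G r i = ereal ((r *\<^sub>R e) i)"
proof -
  have "(augmented G ^^ k) (const_bcontfun r)
    = r *\<^sub>R (augmented G ^^ k) (const_bcontfun 1)" for k
    unfolding const_bcontfun_eq_scaleR[of r] using assms(1)
    by (intro augmented_funpow_homogeneous) (auto simp: linf_pos_def)
  then have "(\<lambda>k. (augmented G ^^ k) (const_bcontfun r) i) \<longlonglongrightarrow> (r *\<^sub>R e) i"
    using tendsto_mult_left[OF assms(2), of r] by simp
  then have "(\<lambda>k. ereal ((augmented G ^^ k) (const_bcontfun r) i)) \<longlonglongrightarrow> ereal ((r *\<^sub>R e) i)"
    by simp
  moreover have "incseq (\<lambda>k. ereal ((augmented G ^^ k) (const_bcontfun r) i))"
    using augmented_funpow_incseq[of "const_bcontfun r" i] by (simp add: incseq_def)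
  ultimately show ?thesis
    unfolding lower_path_def using LIMSEQ_SUP LIMSEQ_unique by blast
qed

text \<open>The fixed point \<open>u\<close> of \<open>augmented_by G r\<close> lies below the
  starting point and hence below all iterates, while the gap to the iterates is controlled by powers
  of \<open>G\<close>, which become arbitrarily small.\<close>

lemma upper_path_eq:
  assumes "0 \<le> r" "e \<in> linf_pos" "augmented_by G 1 e = e" "MBI_witness G \<phi>"
  shows "upper_path G \<phi> r i = ereal ((r *\<^sub>R e) i)"
proof -
  let ?u = "\<lambda>n. (augmented_by G r ^^ n) (const_bcontfun (\<phi> r))"
  define u where "u = r *\<^sub>R e"
  have u: "u \<in> linf_pos"
    using assms(1,2) by (simp add: u_def linf_pos_def)
  have fix_u: "augmented_by G r u = u"
    unfolding u_def by (intro augmented_by_scaleR assms)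
  then have fix_n: "(augmented_by G r ^^ n) u = u" for n
    by (induction n) auto
  \<comment> \<open>A fixed point satisfies the MBI premise with \<open>b\<close> constant
    \<open>r\<close>, so the witness \<open>\<phi>\<close> itself guarantees that the iteration
    starts above \<open>u\<close>.\<close>
  have "u \<sqsubseteq> G u \<squnion> const_bcontfun r"
    using augmented_by_apply[of G r u] fix_u
    by (simp add: linf_le_def linf_max_apply max.commute)
  moreover have "const_bcontfun r \<in> linf_pos"
    using assms(1) by (simp add: linf_pos_def)
  ultimately have norm_u: "norm u \<le> \<phi> r"
    using assms(1,4) u by (metis MBI_witness_def norm_const_linf)
  then have uphi: "u \<sqsubseteq> const_bcontfun (\<phi> r)"
    using linf_le_norm[of u] by (auto simp: linf_le_def intro: order_trans)
  have phi: "const_bcontfun (\<phi> r) \<in> linf_pos"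
    using order_trans[OF norm_ge_zero norm_u] by (simp add: linf_pos_def)
  have diff_pos: "const_bcontfun (\<phi> r) - u \<in> linf_pos"
    using uphi by (simp add: linf_pos_def linf_le_def)
  have low: "u i \<le> ?u n i" and up: "?u n i - u i \<le> (G ^^ n) (const_bcontfun (\<phi> r) - u) i" for n
    using augmented_by_funpow_diff[OF assms(1) u phi uphi, of n] fix_n[of n]
    by (auto simp: linf_le_def)
  have "upper_path G \<phi> r i \<le> ereal (u i)"
  proof (rule ereal_le_epsilon2)
    fix \<epsilon> :: real
    assume \<epsilon>: "0 < \<epsilon>"
    let ?D = "norm (const_bcontfun (\<phi> r) - u)"
    \<comment> \<open>Adding 1 avoids division by zero when the starting point equals
      \<open>u\<close>.\<close>
    have "0 < \<epsilon> / (?D + 1)"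
      using \<epsilon> by (simp add: add_nonneg_pos)
    then obtain n where n: "norm ((G ^^ n) (const_bcontfun 1)) < \<epsilon> / (?D + 1)"
      using norm_funpow_small by blast
    have "(G ^^ n) (const_bcontfun (\<phi> r) - u) i \<le> ?D * norm ((G ^^ n) (const_bcontfun 1))"
      by (rule funpow_le_norm[OF diff_pos])
    also have "\<dots> \<le> (?D + 1) * (\<epsilon> / (?D + 1))"
      using n by (intro mult_mono) auto
    also have "\<dots> = \<epsilon>"
      using add_nonneg_pos[OF norm_ge_zero zero_less_one, of "const_bcontfun (\<phi> r) - u"]
      by (simp only: times_divide_eq_right nonzero_mult_div_cancel_left less_imp_neq[symmetric] simp_thms)
    finally have "?u n i \<le> u i + \<epsilon>"
      using up[of n] by linarith
    then show "upper_path G \<phi> r i \<le> ereal (u i) + ereal \<epsilon>"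
      unfolding upper_path_def by (intro INF_lower2[of n]) auto
  qed
  moreover have "ereal (u i) \<le> upper_path G \<phi> r i"
    unfolding upper_path_def using low by (intro INF_greatest) simp
  ultimately show ?thesis
    by (simp add: u_def)
qed

text \<open>Along a ray the decay condition scales from \<open>e\<close> to every \<open>r\<close>,
  and the inverse components are \<open>x / e i\<close>, whose slopes lie between
  \<open>inverse C\<close> and 1 uniformly in \<open>i\<close>.\<close>

lemma linear_path_of_decay:
  fixes e :: linf
  assumes "\<And>i. 1 \<le> e i" "\<And>i. e i \<le> C" "G e \<sqsubseteq> e"
  shows "path_of_decay G (\<lambda>r. r *\<^sub>R e)"
proof -
  have e0: "0 < e i" for i
    using assms(1)[of i] by simp
  have C: "1 \<le> C"
    using assms(1,2) order_trans by blast
  have ep: "e \<in> linf_pos"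
    using e0 by (simp add: linf_pos_def less_imp_le)
  have inv: "inverse_component (\<lambda>r. r *\<^sub>R e) i x = x / e i" if "0 \<le> x" for i x
  proof -
    have "inj_on (\<lambda>r. r * e i) {0..}"
      using e0[of i] by (auto simp: inj_on_def)
    from inv_into_f_f[OF this, of "x / e i"] show ?thesis
      using e0[of i] that by (simp add: inverse_component_def)
  qed
  have slopes: "inverse C * \<bar>r1 - r2\<bar> \<le> \<bar>r1 / e i - r2 / e i\<bar>"
    "\<bar>r1 / e i - r2 / e i\<bar> \<le> 1 * \<bar>r1 - r2\<bar>" for r1 r2 i
  proof -
    have *: "\<bar>r1 / e i - r2 / e i\<bar> = inverse (e i) * \<bar>r1 - r2\<bar>"
      using e0[of i] by (simp add: abs_mult field_simps flip: diff_divide_distrib)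
    show "inverse C * \<bar>r1 - r2\<bar> \<le> \<bar>r1 / e i - r2 / e i\<bar>"
      unfolding * using assms(2) e0 by (intro mult_right_mono le_imp_inverse_le) auto
    show "\<bar>r1 / e i - r2 / e i\<bar> \<le> 1 * \<bar>r1 - r2\<bar>"
      unfolding * using assms(1)[of i] by (intro mult_right_mono inverse_le_1_iff[THEN iffD2]) auto
  qed
  show ?thesis
    unfolding path_of_decay_def
  proof (intro conjI allI impI)
    fix r :: real
    assume r: "0 \<le> r"
    show "r *\<^sub>R e \<in> linf_pos"
      using r ep by (simp add: linf_pos_def)
    show "G (r *\<^sub>R e) \<sqsubseteq> r *\<^sub>R e"
      using r ep assms(3) by (simp add: homogeneous linf_le_def mult_left_mono)
  next
    show "\<exists>\<sigma>min\<in>class_K_inf. \<exists>\<sigma>max\<in>class_K_inf.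
        \<forall>i. \<forall>r\<ge>0. \<sigma>min r \<le> (r *\<^sub>R e) i \<and> (r *\<^sub>R e) i \<le> \<sigma>max r"
    proof (intro bexI allI impI)
      fix i and r :: real
      assume "0 \<le> r"
      then show "r * 1 \<le> (r *\<^sub>R e) i \<and> (r *\<^sub>R e) i \<le> r * C"
        using assms(1,2) by (simp add: mult_left_mono mult_le_cancel_left1)
    qed (use C in \<open>intro linear_class_K_inf; linarith\<close>)+
  next
    fix i
    show "(\<lambda>r. (r *\<^sub>R e) i) \<in> class_K_inf"
      using linear_class_K_inf[OF e0[of i]] by simp
  next
    fix a b :: real
    assume "0 < a \<and> a \<le> b"
    then show "\<exists>c C. 0 < c \<and> c \<le> C \<and> (\<forall>r1\<in>{a..b}. \<forall>r2\<in>{a..b}. \<forall>i.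
        c * \<bar>r1 - r2\<bar> \<le> \<bar>inverse_component (\<lambda>r. r *\<^sub>R e) i r1
          - inverse_component (\<lambda>r. r *\<^sub>R e) i r2\<bar> \<and>
        \<bar>inverse_component (\<lambda>r. r *\<^sub>R e) i r1
          - inverse_component (\<lambda>r. r *\<^sub>R e) i r2\<bar> \<le> C * \<bar>r1 - r2\<bar>)"
      \<comment> \<open>The same two constants serve every interval; \<open>0 < a\<close> is used
        only to place the points in \<open>{0..}\<close>, where \<open>inv\<close> applies.\<close>
      using C slopes
      by (intro exI[of _ "inverse C"] exI[of _ 1]) (auto simp: inv inverse_le_1_iff)
  qed
qed

text \<open>The ray through \<open>e\<close> is constructed without reference to
  \<open>\<phi>\<close>, so a single path equals the upper path for every witness.\<close>

lemma extremal_paths: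
  "\<exists>\<sigma> :: real \<Rightarrow> linf.
    (\<forall>r\<ge>0. \<forall>i. ereal (apply_bcontfun (\<sigma> r) i) = lower_path G r i) \<and>
    (\<forall>\<phi>. MBI_witness G \<phi> \<longrightarrow>
       (\<forall>r\<ge>0. \<forall>i. ereal (apply_bcontfun (\<sigma> r) i) = upper_path G \<phi> r i)) \<and>
    path_of_decay G \<sigma> \<and>
    (\<exists>L. L-lipschitz_on {0..} \<sigma>)"
proof -
  obtain e :: linf and C where ge: "\<And>i. 1 \<le> e i" and le: "\<And>i. e i \<le> C"
    and fixed: "augmented_by G 1 e = e"
    and lim: "\<And>i. (\<lambda>k. (augmented G ^^ k) (const_bcontfun 1) i) \<longlonglongrightarrow> e i"
    using extremal_fixed_point by blast
  have ep: "e \<in> linf_pos"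
    using ge by (intro linf_posI) (blast intro: order_trans zero_le_one)
  have "G e \<sqsubseteq> e"
    unfolding linf_le_def using augmented_by_apply[of G 1 e] fixed by simp
  then have "path_of_decay G (\<lambda>r. r *\<^sub>R e)"
    by (intro linear_path_of_decay[OF ge le])
  moreover have "(norm e)-lipschitz_on {0..} (\<lambda>r. r *\<^sub>R e)"
    by (rule lipschitz_onI)
      (simp_all add: dist_norm scaleR_diff_left[symmetric] mult.commute del: scaleR_diff_left)
  ultimately show ?thesis
    using lower_path_eq[OF _ lim] upper_path_eq[OF _ ep fixed]
    by (intro exI[of _ "\<lambda>r. r *\<^sub>R e"]) auto
qed

end

section \<open>Subadditive homogeneous gain operators\<close>

lemma slope_nonneg:
  assumes "gain_data I \<gamma> \<mu>"
  shows "0 \<le> slope (\<gamma> i j)"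
proof -
  consider "\<gamma> i j \<in> class_K" | "\<forall>r\<ge>0. \<gamma> i j r = 0"
    using assms by (auto simp: gain_data_def)
  then show ?thesis
  proof cases
    case 1
    then have "\<gamma> i j 0 < \<gamma> i j 1" "\<gamma> i j 0 = 0"
      using strict_mono_onD[of "{0..}" "\<gamma> i j" 0 1] by (auto simp: class_K_def)
    then show ?thesis
      by (simp add: slope_def)
  qed (simp add: slope_def)
qed

lemma gain_seq_linear:
  assumes "gain_data I \<gamma> \<mu>" "subadditive_homogeneous \<gamma> \<mu>" "s \<in> linf_pos"
  shows "gain_seq \<gamma> i s j = slope (\<gamma> i j) * s j"
  using assms by (simp add: gain_seq_apply subadditive_homogeneous_def linf_posD)

lemma gain_seq_pos_on:
  assumes "gain_data I \<gamma> \<mu>" "subadditive_homogeneous \<gamma> \<mu>" "s \<in> linf_pos"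
  shows "gain_seq \<gamma> i s \<in> linf_pos_on (I i)"
proof -
  have "slope (\<gamma> i j) = 0" if "j \<notin> I i" for j
    using that assms(1) by (simp add: gain_data_def slope_def)
  then show ?thesis
    using assms by (simp add: linf_pos_on_def linf_pos_def gain_seq_linear slope_nonneg)
qed

text \<open>The gains are linear with nonnegative slopes, so \<open>gain_seq\<close> is linear and
  monotone, and each property is inherited from the aggregation functions. The comparisons are made
  in \<open>ennreal\<close> and carried back to the reals by nonnegativity.\<close>

lemma gain_op_subadditive_operator:
  assumes data: "gain_data I \<gamma> \<mu>"
    and sh: "subadditive_homogeneous \<gamma> \<mu>"
    and wd: "gain_well_defined \<gamma> \<mu>"
  shows "subadditive_operator (gain_op \<gamma> \<mu>)"
proof
  let ?G = "gain_op \<gamma> \<mu>"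
  note linear = gain_seq_linear[OF data sh]
  note pos = gain_op_apply(1)[OF wd]
  have G: "ennreal (?G s i) = \<mu> i (gain_seq \<gamma> i s)" if "s \<in> linf_pos" for s i
    using gain_op_apply(2)[OF wd that] by (simp add: gain_comp_def)
  have seq_pos: "gain_seq \<gamma> i s \<in> linf_pos" if "s \<in> linf_pos" for i s
    using gain_seq_pos_on[OF data sh that] by (simp add: linf_pos_on_def)
  have maf_mono: "\<mu> i s \<le> \<mu> i t" if "s \<in> linf_pos" "t \<in> linf_pos" "s \<sqsubseteq> t" for i s t
    using data that by (auto simp: gain_data_def MAF_def)
  fix s t :: linf and r :: real
  assume s: "s \<in> linf_pos"
  show "?G s \<in> linf_pos"
    by (rule pos[OF s])
  {
    assume r: "0 \<le> r"
    have rs: "r *\<^sub>R s \<in> linf_pos"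
      using r s by (simp add: linf_pos_def)
    show "?G (r *\<^sub>R s) = r *\<^sub>R ?G s"
    proof (rule bcontfun_eqI)
      fix i
      have "gain_seq \<gamma> i (r *\<^sub>R s) = r *\<^sub>R gain_seq \<gamma> i s"
        by (rule bcontfun_eqI) (simp add: linear rs s)
      then have "ennreal (?G (r *\<^sub>R s) i) = ennreal r * ennreal (?G s i)"
        using sh r seq_pos[OF s] by (simp add: G rs s subadditive_homogeneous_def)
      also have "\<dots> = ennreal (r * ?G s i)"
        using r pos[OF s] by (simp add: ennreal_mult linf_posD)
      finally show "?G (r *\<^sub>R s) i = (r *\<^sub>R ?G s) i"
        using r pos[OF rs] pos[OF s] by (simp add: linf_posD)
    qed
  }
  assume t: "t \<in> linf_pos"
  have st: "s + t \<in> linf_pos"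
    using s t by (simp add: linf_pos_def)
  show "?G (s + t) \<sqsubseteq> ?G s + ?G t"
    unfolding linf_le_def
  proof
    fix i
    have "gain_seq \<gamma> i (s + t) = gain_seq \<gamma> i s + gain_seq \<gamma> i t"
      by (rule bcontfun_eqI) (simp add: linear s t st distrib_left)
    then have "ennreal (?G (s + t) i) \<le> ennreal (?G s i) + ennreal (?G t i)"
      using sh seq_pos[OF s] seq_pos[OF t] by (simp add: G s t st subadditive_homogeneous_def)
    then show "?G (s + t) i \<le> (?G s + ?G t) i"
      using pos[OF s] pos[OF t] by (simp add: linf_posD flip: ennreal_plus)
  qed
  assume le: "s \<sqsubseteq> t"
  show "?G s \<sqsubseteq> ?G t"
    unfolding linf_le_def
  proof
    fix i
    have "gain_seq \<gamma> i s \<sqsubseteq> gain_seq \<gamma> i t"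
      using le slope_nonneg[OF data] by (simp add: linf_le_def linear s t mult_left_mono)
    then have "ennreal (?G s i) \<le> ennreal (?G t i)"
      by (simp add: G s t maf_mono seq_pos)
    then show "?G s i \<le> ?G t i"
      using pos[OF t] by (simp add: linf_posD)
  qed
qed

text \<open>Component \<open>i\<close> reads only the coordinates in the finite set
  \<open>I i\<close>, and \<open>\<mu> i\<close> is continuous on sequences supported there.\<close>

lemma gain_op_finitary:
  assumes data: "gain_data I \<gamma> \<mu>"
    and sh: "subadditive_homogeneous \<gamma> \<mu>"
    and wd: "gain_well_defined \<gamma> \<mu>"
    and S: "\<And>n :: nat. S n \<in> linf_pos" and t: "t \<in> linf_pos"
    and lim: "\<And>j. (\<lambda>n. S n j) \<longlonglongrightarrow> t j"
  shows "(\<lambda>n. gain_op \<gamma> \<mu> (S n) i) \<longlonglongrightarrow> gain_op \<gamma> \<mu> t i"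
proof -
  have fin: "finite (I i)" and maf: "continuous_on (linf_pos_on (I i)) (\<mu> i)"
    using data by (auto simp: gain_data_def MAF_def)
  have "(\<lambda>n. gain_seq \<gamma> i (S n)) \<longlonglongrightarrow> gain_seq \<gamma> i t"
    by (rule tendsto_finite_support[OF fin gain_seq_pos_on[OF data sh S]
          gain_seq_pos_on[OF data sh t]])
      (simp add: gain_seq_linear[OF data sh] S t tendsto_mult_left lim)
  then have "(\<lambda>n. \<mu> i (gain_seq \<gamma> i (S n))) \<longlonglongrightarrow> \<mu> i (gain_seq \<gamma> i t)"
    by (rule continuous_on_tendsto_compose[OF maf])
      (simp_all add: gain_seq_pos_on[OF data sh] S t)
  then have "(\<lambda>n. ennreal (gain_op \<gamma> \<mu> (S n) i)) \<longlonglongrightarrow> ennreal (gain_op \<gamma> \<mu> t i)"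
    by (simp add: gain_op_apply(2)[OF wd] S t gain_comp_def)
  then show ?thesis
    using gain_op_apply(1)[OF wd S] gain_op_apply(1)[OF wd t]
    by (subst (asm) tendsto_ennreal_iff) (auto simp: linf_posD)
qed

theorem corollary5p8:
  fixes I :: "nat \<Rightarrow> nat set"
    and \<gamma> :: "nat \<Rightarrow> nat \<Rightarrow> real \<Rightarrow> real"
    and \<mu> :: "nat \<Rightarrow> linf \<Rightarrow> ennreal"
  assumes "gain_data I \<gamma> \<mu>"
    and "subadditive_homogeneous \<gamma> \<mu>"
    and "gain_well_defined \<gamma> \<mu>"
    and "continuous_on linf_pos (gain_op \<gamma> \<mu>)"
    and "(INF n\<in>{1..}. norm ((gain_op \<gamma> \<mu> ^^ n) (const_bcontfun 1))) < 1"
    and "\<exists>c>1. \<forall>i. \<forall>j\<in>I i. inverse c \<le> slope (\<gamma> i j) \<and> slope (\<gamma> i j) \<le> c"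
    and "\<forall>R1 R2. 0 < R1 \<and> R1 < R2 \<longrightarrow>
           (\<exists>l>0. \<forall>i. \<forall>j\<in>I i. \<forall>s1 s2.
              const_bcontfun R1 \<sqsubseteq> s1 \<and> s1 \<sqsubseteq> s2 \<and> s2 \<sqsubseteq> const_bcontfun R2 \<longrightarrow>
              \<mu> i s2 - \<mu> i s1 \<ge> ennreal (l * (s2 j - s1 j)))"
  shows "(\<exists>\<phi>. MBI_witness (gain_op \<gamma> \<mu>) \<phi>) \<and>
         (\<exists>\<sigma> :: real \<Rightarrow> linf.
            (\<forall>r\<ge>0. \<forall>i. ereal (apply_bcontfun (\<sigma> r) i) = lower_path (gain_op \<gamma> \<mu>) r i) \<and>
            (\<forall>\<phi>. MBI_witness (gain_op \<gamma> \<mu>) \<phi> \<longrightarrow>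
               (\<forall>r\<ge>0. \<forall>i. ereal (apply_bcontfun (\<sigma> r) i) = upper_path (gain_op \<gamma> \<mu>) \<phi> r i)) \<and>
            path_of_decay (gain_op \<gamma> \<mu>) \<sigma> \<and>
            (\<exists>L. L-lipschitz_on {0..} \<sigma>))"
proof -
  \<comment> \<open>Norms are bounded below by 0, so the real infimum is a genuine one, and being
    below 1 it yields an exponent with norm below 1.\<close>
  have "\<exists>n\<in>{1..}. norm ((gain_op \<gamma> \<mu> ^^ n) (const_bcontfun 1)) < 1"
    using assms(5) by (subst (asm) cINF_less_iff) (auto simp: bdd_below_def intro: exI[of _ 0])
  then interpret contractive_operator "gain_op \<gamma> \<mu>"
    using gain_op_subadditive_operator[OF assms(1-3)] gain_op_finitary[OF assms(1-3)]
    by (auto simp: contractive_operator_def contractive_operator_axioms_def)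
  show ?thesis
    using MBI_witness_exists extremal_paths by blast
qed

end
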